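(* Let $\psi$ be a combinatorially-aware relative positional encoding (RPE). Then $\psi$-RPE-GTs are at least as strong as MPNNs: if two featured graphs $(G,X_G)$ and $(H,X_H)$ are indistinguishable by all $\psi$-RPE-GTs, then they are indistinguishable by all message passing graph neural networks (MPNNs).
   Context: Graphs are finite, simple, undirected and unweighted. A featured graph $(G,X_G)$ is a graph with node features $X_G:V_G\to\mathbb{R}^d$. An RPE $\psi$ assigns each graph $G$ a map $\psi_G:V_G\times V_G\to\mathbb{R}^k$ with $\psi_G=\psi_H\circ(\sigma\times\sigma)$ for every graph isomorphism $\sigma:V_G\to V_H$. $\psi$ is combinatorially-aware if for any graphs $G,H$, $u,v\in V_G$, $x,y\in V_H$: $\psi_G(u,v)=\psi_H(x,y)$ only if either ($\{u,v\}\in E_G$ and $\{x,y\}\in E_H$) or ($\{u,v\}\notin E_G$ and $\{x,y\}\notin E_H$). An MPNN computes node features by layers $h^{(0)}(v)=X_G(v)$, $h^{(t+1)}(v)=U_t\big(h^{(t)}(v),M_t(\{\!\{h^{(t)}(u):\{u,v\}\in E_G\}\!\})\big)$, with arbitrary update and (multiset) aggregation functions $U_t,M_t$; two featured graphs are indistinguishable by it if the multisets of final node features are equal. Transformer: a composition of layers $X^{(l)}\mapsto X^{(l+1)}$ on $\mathbb{R}^{n\times d}$ (same parameters for every $n$), where, with heads $1\le h\le H$, $$Y^{(l)}=X^{(l)}+\Big(\sum_{h=1}^H A^{(l,h)}(X^{(l)})X^{(l)}W_V^{(l,h)}\Big)W_O^{(l)},\quad X^{(l+1)}=Y^{(l)}+\sigma(Y^{(l)}W_1^{(l)})W_2^{(l)},$$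 with $W_V\in\mathbb{R}^{d\times d_h}$, $W_O\in\mathbb{R}^{d_h\times d}$, $W_1\in\mathbb{R}^{d\times d_r}$, $W_2\in\mathbb{R}^{d_r\times d}$ and $\sigma$ an entrywise activation function (usually GELU). A $\psi$-RPE-GT is such a network applied to $X_G$ with attention matrices $A(X)=f_1(\psi_G)\odot\mathrm{softmax}\big(XW_Q(XW_K)^T/\sqrt{d_h}+f_2(\psi_G)\big)$, where $W_Q,W_K\in\mathbb{R}^{d\times d_h}$, softmax is row-wise, $f_1,f_2:\mathbb{R}^k\to\mathbb{R}$ are functions applied to each entry $\psi_G(u,v)$ (they may differ between layers and heads), and $\odot$ is the entrywise product. Two featured graphs are indistinguishable by a graph transformer if its outputs have the same multiset of node features (rows). *)

theory Defs
  imports "HOL-Analysis.Analysis" "HOL-Library.Multiset"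
begin

section \<open>Graphs and relative positional encodings\<close>

record 'v ugraph =
  verts :: "'v set"
  edges :: "'v set set"

definition simple_graph :: "'v ugraph \<Rightarrow> bool" where
  "simple_graph G \<longleftrightarrow> finite (verts G) \<and> (\<forall>e\<in>edges G. e \<subseteq> verts G \<and> card e = 2)"

definition graph_iso :: "('v \<Rightarrow> 'v) \<Rightarrow> 'v ugraph \<Rightarrow> 'v ugraph \<Rightarrow> bool" where
  "graph_iso \<pi> G H \<longleftrightarrow> bij_betw \<pi> (verts G) (verts H) \<and>
     (\<forall>u\<in>verts G. \<forall>v\<in>verts G. {u, v} \<in> edges G \<longleftrightarrow> {\<pi> u, \<pi> v} \<in> edges H)"

text \<open>
  Only the values of \<open>\<psi> G\<close> on \<open>verts G \<times> verts G\<close>, for simple graphs \<open>G\<close>, are relevant.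
  All graphs have their vertices in one arbitrary type \<open>'v\<close>; an infinite \<open>'v\<close> contains a copy of
  every finite graph.
\<close>

definition is_rpe :: "('v ugraph \<Rightarrow> 'v \<Rightarrow> 'v \<Rightarrow> 'p) \<Rightarrow> bool" where
  "is_rpe \<psi> \<longleftrightarrow> (\<forall>G H \<pi>. simple_graph G \<longrightarrow> simple_graph H \<longrightarrow> graph_iso \<pi> G H \<longrightarrow>
     (\<forall>u\<in>verts G. \<forall>v\<in>verts G. \<psi> G u v = \<psi> H (\<pi> u) (\<pi> v)))"

definition combinatorially_aware :: "('v ugraph \<Rightarrow> 'v \<Rightarrow> 'v \<Rightarrow> 'p) \<Rightarrow> bool" where
  "combinatorially_aware \<psi> \<longleftrightarrow> (\<forall>G H. simple_graph G \<longrightarrow> simple_graph H \<longrightarrow>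
     (\<forall>u\<in>verts G. \<forall>v\<in>verts G. \<forall>x\<in>verts H. \<forall>y\<in>verts H. \<psi> G u v = \<psi> H x y \<longrightarrow>
        ({u, v} \<in> edges G \<and> {x, y} \<in> edges H) \<or> ({u, v} \<notin> edges G \<and> {x, y} \<notin> edges H)))"


section \<open>Message passing networks\<close>

record ('f, 'm) mpnn =
  update :: "nat \<Rightarrow> 'f \<Rightarrow> 'm \<Rightarrow> 'f"
  aggregate :: "nat \<Rightarrow> 'f multiset \<Rightarrow> 'm"
  mpnn_depth :: nat

primrec mpnn_features ::
  "('f, 'm) mpnn \<Rightarrow> 'v ugraph \<Rightarrow> ('v \<Rightarrow> 'f) \<Rightarrow> nat \<Rightarrow> 'v \<Rightarrow> 'f" where
  "mpnn_features N G X 0 = X"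
| "mpnn_features N G X (Suc t) = (\<lambda>v. update N t (mpnn_features N G X t v)
     (aggregate N t (image_mset (mpnn_features N G X t) (mset_set {u. {u, v} \<in> edges G}))))"

text \<open>
  The input features lie in \<open>real ^ 'd\<close>, but the later layers may use other feature spaces. The
  features of all layers are collected in the sum type \<open>(real ^ 'd) + 'b\<close> with \<open>'b\<close> arbitrary; for
  example \<open>'b = real list\<close> accommodates layers of any finite widths.
\<close>

definition mpnn_indistinguishable ::
  "((real ^ 'd) + 'b, 'm) mpnn \<Rightarrow> 'v ugraph \<Rightarrow> ('v \<Rightarrow> real ^ 'd) \<Rightarrow>
     'v ugraph \<Rightarrow> ('v \<Rightarrow> real ^ 'd) \<Rightarrow> bool" where
  "mpnn_indistinguishable N G X H Y \<longleftrightarrow>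
     image_mset (mpnn_features N G (\<lambda>v. Inl (X v)) (mpnn_depth N)) (mset_set (verts G)) =
     image_mset (mpnn_features N H (\<lambda>v. Inl (Y v)) (mpnn_depth N)) (mset_set (verts H))"


section \<open>Graph transformers with relative positional encodings\<close>

text \<open>
  The sizes of the weight matrices and the number of nodes vary from network to network and from
  graph to graph, so matrices are functions of a row and a column index, and products carry the
  summation range: \<open>UNIV :: 'd set\<close> for the width \<open>d\<close>, \<open>{..<d\<^sub>h}\<close> and \<open>{..<d\<^sub>r}\<close> for the
  inner dimensions, and the vertex set for the nodes. Entries outside these ranges are never used.
\<close>

definition mat_prod ::
  "'j set \<Rightarrow> ('i \<Rightarrow> 'j \<Rightarrow> real) \<Rightarrow> ('j \<Rightarrow> 'l \<Rightarrow> real) \<Rightarrow> 'i \<Rightarrow> 'l \<Rightarrow> real" where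
  "mat_prod J A B = (\<lambda>i l. \<Sum>j\<in>J. A i j * B j l)"

definition softmax :: "'v set \<Rightarrow> ('v \<Rightarrow> 'v \<Rightarrow> real) \<Rightarrow> 'v \<Rightarrow> 'v \<Rightarrow> real" where
  "softmax V B = (\<lambda>u v. exp (B u v) / (\<Sum>w\<in>V. exp (B u w)))"

record ('d, 'p) rpe_head =
  W_Q :: "'d \<Rightarrow> nat \<Rightarrow> real"
  W_K :: "'d \<Rightarrow> nat \<Rightarrow> real"
  W_V :: "'d \<Rightarrow> nat \<Rightarrow> real"
  f\<^sub>1 :: "'p \<Rightarrow> real"
  f\<^sub>2 :: "'p \<Rightarrow> real"

record ('d, 'p) rpe_layer =
  heads :: "nat \<Rightarrow> ('d, 'p) rpe_head"
  W_O :: "nat \<Rightarrow> 'd \<Rightarrow> real"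
  W\<^sub>1 :: "'d \<Rightarrow> nat \<Rightarrow> real"
  W\<^sub>2 :: "nat \<Rightarrow> 'd \<Rightarrow> real"

text \<open>
  The activation function is part of the network, like its sizes, and is shared by all layers. It
  cannot be fixed in advance: there are no bias terms, so if it vanishes at \<open>0\<close> (as GELU does), zero
  features stay zero whatever the graph.
\<close>

record ('d, 'p) rpe_gt =
  num_heads :: nat
  head_dim :: nat
  ff_dim :: nat
  activation :: "real \<Rightarrow> real"
  layers :: "('d, 'p) rpe_layer list"

definition is_rpe_gt :: "('d, 'p) rpe_gt \<Rightarrow> bool" where
  "is_rpe_gt N \<longleftrightarrow> num_heads N \<ge> 1 \<and> head_dim N \<ge> 1 \<and> ff_dim N \<ge> 1"

text \<open>In the following, \<open>V\<close> is the vertex set of the graph and \<open>P\<close> its positional encoding.\<close>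

definition attention ::
  "('d::finite, 'p) rpe_gt \<Rightarrow> 'v set \<Rightarrow> ('v \<Rightarrow> 'v \<Rightarrow> 'p) \<Rightarrow> ('d, 'p) rpe_head \<Rightarrow>
     ('v \<Rightarrow> 'd \<Rightarrow> real) \<Rightarrow> 'v \<Rightarrow> 'v \<Rightarrow> real" where
  "attention N V P h X =
     (let Q = mat_prod UNIV X (W_Q h);
          K = mat_prod UNIV X (W_K h);
          QKt = mat_prod {..<head_dim N} Q (\<lambda>j v. K v j)
      in (\<lambda>u v. f\<^sub>1 h (P u v) *
            softmax V (\<lambda>u v. QKt u v / sqrt (real (head_dim N)) + f\<^sub>2 h (P u v)) u v))"

definition gt_layer ::
  "('d::finite, 'p) rpe_gt \<Rightarrow> 'v set \<Rightarrow> ('v \<Rightarrow> 'v \<Rightarrow> 'p) \<Rightarrow> ('d, 'p) rpe_layer \<Rightarrow>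
     ('v \<Rightarrow> 'd \<Rightarrow> real) \<Rightarrow> 'v \<Rightarrow> 'd \<Rightarrow> real" where
  "gt_layer N V P L X =
     (let S = (\<lambda>v j. \<Sum>h=1..num_heads N.
                mat_prod UNIV (mat_prod V (attention N V P (heads L h) X) X) (W_V (heads L h)) v j);
          Y = (\<lambda>v i. X v i + mat_prod {..<head_dim N} S (W_O L) v i);
          R = (\<lambda>v j. activation N (mat_prod UNIV Y (W\<^sub>1 L) v j))
      in (\<lambda>v i. Y v i + mat_prod {..<ff_dim N} R (W\<^sub>2 L) v i))"

definition gt_output ::
  "('v ugraph \<Rightarrow> 'v \<Rightarrow> 'v \<Rightarrow> 'p) \<Rightarrow> ('d::finite, 'p) rpe_gt \<Rightarrow> 'v ugraph \<Rightarrow>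
     ('v \<Rightarrow> real ^ 'd) \<Rightarrow> 'v \<Rightarrow> real ^ 'd" where
  "gt_output \<psi> N G X = (\<lambda>v. \<chi> i.
     fold (gt_layer N (verts G) (\<psi> G)) (layers N) (\<lambda>v i. X v $ i) v i)"

definition gt_indistinguishable ::
  "('v ugraph \<Rightarrow> 'v \<Rightarrow> 'v \<Rightarrow> 'p) \<Rightarrow> ('d::finite, 'p) rpe_gt \<Rightarrow>
     'v ugraph \<Rightarrow> ('v \<Rightarrow> real ^ 'd) \<Rightarrow> 'v ugraph \<Rightarrow> ('v \<Rightarrow> real ^ 'd) \<Rightarrow> bool" where
  "gt_indistinguishable \<psi> N G X H Y \<longleftrightarrow>
     image_mset (gt_output \<psi> N G X) (mset_set (verts G)) =
     image_mset (gt_output \<psi> N H Y) (mset_set (verts H))"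

end

theory Submission
  imports Defs "HOL-Real_Asymp.Real_Asymp"
begin

text \<open>
  Only one coordinate \<open>i\<^sub>0\<close> of the features is ever rewritten. With constant attention scores the
  softmax is uniform, so that \<open>f\<^sub>1\<close>, which sees the edges by combinatorial awareness, turns attention
  into the sum over the neighbours. A first layer projects the input along a generic vector and
  stores the exponential of the result in coordinate \<open>i\<^sub>0\<close>. A message passing step is then simulated
  by two layers: the map \<open>y \<mapsto> y + exp (c y)\<close> with \<open>c\<close> large makes sums determine multisets, and
  \<open>s + a S\<close> with \<open>a\<close> large determines both the own value \<open>s\<close> and the sum \<open>S\<close> over the neighbours.
  One activation serves all layers: it is \<open>exp\<close> up to a correction at finitely many points, which
  cancels the residual connection of the first layer and is avoided by scaling in the other layers.
\<close>

section \<open>Multisets and generic parameters\<close>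

text \<open>\<open>imp\<close> compares only elements of \<open>A\<close> with elements of
  \<open>B\<close>. Two elements of \<open>A\<close> with equal \<open>f\<close>-values are still
  covered: by \<open>eq\<close> some \<open>b\<close> in \<open>B\<close> has this value, and both
  are compared with \<open>b\<close>. So \<open>f'\<close> and \<open>g'\<close> factor through one
  function \<open>r\<close> of the common values.\<close>

lemma image_mset_eq_transfer:
  assumes eq: "image_mset f A = image_mset g B"
    and imp: "\<And>a b. a \<in># A \<Longrightarrow> b \<in># B \<Longrightarrow> f a = g b \<Longrightarrow> f' a = g' b"
  shows "image_mset f' A = image_mset g' B"
proof -
  define r where "r z = f' (SOME a. a \<in># A \<and> f a = z)" for z
  have g': "r (g b) = g' b" if "b \<in># B" for b
  proof -
    have "g b \<in># image_mset f A"
      using that eq by simp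
    then have "\<exists>a. a \<in># A \<and> f a = g b"
      by auto
    then have "(SOME a. a \<in># A \<and> f a = g b) \<in># A \<and> f (SOME a. a \<in># A \<and> f a = g b) = g b"
      by (rule someI_ex)
    then show ?thesis
      unfolding r_def using imp that by blast
  qed
  have f': "r (f a) = f' a" if "a \<in># A" for a
  proof -
    have "f a \<in># image_mset g B"
      using that eq[symmetric] by simp
    then obtain b where "b \<in># B" "f a = g b"
      by auto
    then show ?thesis
      using g' imp that by metis
  qed
  have "image_mset f' A = image_mset r (image_mset f A)"
    using f' by (simp add: multiset.map_comp cong: image_mset_cong)
  also have "\<dots> = image_mset g' B"
    unfolding eq using g' by (simp add: multiset.map_comp cong: image_mset_cong)
  finally show ?thesis .
qed

text \<open>At most one \<open>a\<close> is excluded. The form with \<open>eventually\<close> lets a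
  single \<open>a\<close> meet finitely many such conditions together with a sign condition.\<close>

lemma eventually_affine_nonzero:
  fixes p q :: real
  assumes "p \<noteq> 0 \<or> q \<noteq> 0"
  shows "eventually (\<lambda>a. p + a * q \<noteq> 0) at_top"
proof (cases "q = 0")
  case False
  have "eventually (\<lambda>a. a > - p / q) at_top"
    by (rule eventually_gt_at_top)
  then show ?thesis
  proof eventually_elim
    case (elim a)
    show ?case
    proof
      assume "p + a * q = 0"
      then have "a * q = - p"
        by linarith
      then have "a = - p / q"
        using False by (metis nonzero_mult_div_cancel_right)
      with elim show False
        by simp
    qed
  qed
qed (use assms in simp)

lemma exists_nonorthogonal:
  fixes D :: "'a::real_inner set"
  assumes "finite D" and "0 \<notin> D"
  shows "\<exists>w. \<forall>x\<in>D. x \<bullet> w \<noteq> 0"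
  using assms
proof (induction D)
  case (insert x D)
  then obtain w where w: "\<forall>z\<in>D. z \<bullet> w \<noteq> 0"
    by auto
  \<comment> \<open>A large multiple of \<open>x\<close> is added to \<open>w\<close>: for
    \<open>z = x\<close> the slope \<open>x \<bullet> x\<close> is nonzero, for \<open>z\<close> in
    \<open>D\<close> the constant term is.\<close>
  have "eventually (\<lambda>a. \<forall>z\<in>insert x D. z \<bullet> w + a * (z \<bullet> x) \<noteq> 0) at_top"
    using insert w by (intro eventually_ball_finite ballI eventually_affine_nonzero) auto
  then obtain a where "\<forall>z\<in>insert x D. z \<bullet> w + a * (z \<bullet> x) \<noteq> 0"
    using eventually_happens'[OF trivial_limit_at_top_linorder] by blast
  then have "\<forall>z\<in>insert x D. z \<bullet> (w + a *\<^sub>R x) \<noteq> 0"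
    by (simp add: inner_add_right)
  then show ?case
    by blast
qed simp

text \<open>A direction that is orthogonal to no nonzero difference of elements of \<open>F\<close>
  keeps them apart. Such a projection compresses the finitely many input vectors to numbers without
  loss.\<close>

lemma exists_inj_on_inner:
  fixes F :: "'a::real_inner set"
  assumes "finite F"
  shows "\<exists>w. inj_on (\<lambda>x. x \<bullet> w) F"
proof -
  let ?D = "(\<lambda>(x, y). x - y) ` (F \<times> F) - {0}"
  have "finite ?D"
    using assms by blast
  then obtain w where w: "\<forall>z\<in>?D. z \<bullet> w \<noteq> 0"
    using exists_nonorthogonal[of ?D] by blast
  have "inj_on (\<lambda>x. x \<bullet> w) F"
  proof (rule inj_onI, rule ccontr)
    fix x y
    assume "x \<in> F" "y \<in> F" "x \<bullet> w = y \<bullet> w" "x \<noteq> y"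
    then have "x - y \<in> ?D"
      by (auto intro: rev_image_eqI[of "(x, y)"])
    with w have "(x - y) \<bullet> w \<noteq> 0"
      by blast
    then show False
      using \<open>x \<bullet> w = y \<bullet> w\<close> by (simp add: inner_diff_left)
  qed
  then show ?thesis
    by blast
qed

text \<open>For large \<open>c\<close> the largest number whose multiplicities in \<open>A\<close>
  and \<open>B\<close> differ dominates the difference of the sums. Positivity makes its exponential
  grow, so that the linear terms, which stem from the residual connection, become
  negligible.\<close>

lemma eventually_sum_exp_separates:
  fixes A B :: "real multiset"
  assumes pos: "\<forall>y \<in># A + B. y > 0" and ne: "A \<noteq> B"
  shows "eventually (\<lambda>c. (\<Sum>y\<in>#A. y + exp (c * y)) \<noteq> (\<Sum>y\<in>#B. y + exp (c * y))) at_top"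
proof -
  define m where "m y = real (count A y) - real (count B y)" for y
  define F where "F = {y. m y \<noteq> 0}"
  have sub: "F \<subseteq> set_mset (A + B)"
    by (auto simp: F_def m_def not_in_iff)
  have fin: "finite F"
    by (rule finite_subset[OF sub]) simp
  have "F \<noteq> {}"
    using ne by (auto simp: F_def m_def multiset_eq_iff)
  define M where "M = Max F"
  have M: "M \<in> F"
    using fin \<open>F \<noteq> {}\<close> by (simp add: M_def)
  have M0: "M > 0"
    using M sub pos by blast
  have le: "y \<le> M" if "y \<in> F" for y
    using fin that by (simp add: M_def)
  have diff: "(\<Sum>y\<in>#A. g y) - (\<Sum>y\<in>#B. g y) = (\<Sum>y\<in>F. m y * g y)" for g :: "real \<Rightarrow> real"
  proof -
    let ?U = "set_mset (A + B)"
    have *: "(\<Sum>y\<in>#C. g y) = (\<Sum>y\<in>?U. real (count C y) * g y)" if "set_mset C \<subseteq> ?U" for C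
      using that
    proof (induction C)
      case (add x C)
      have "(\<Sum>y\<in>?U. real (count (add_mset x C) y) * g y) =
          (\<Sum>y\<in>?U. real (count C y) * g y + (if y = x then g x else 0))"
        by (rule sum.cong) (auto simp: distrib_right)
      also have "\<dots> = (\<Sum>y\<in>?U. real (count C y) * g y) + g x"
        using add.prems by (subst sum.distrib) simp
      finally show ?case
        using add by simp
    qed simp
    have "(\<Sum>y\<in>#A. g y) - (\<Sum>y\<in>#B. g y) = (\<Sum>y\<in>?U. m y * g y)"
      unfolding *[of A, simplified] *[of B, simplified]
      by (simp add: m_def sum_subtractf left_diff_distrib)
    also have "\<dots> = (\<Sum>y\<in>F. m y * g y)"
      using sub by (intro sum.mono_neutral_right) (auto simp: F_def)
    finally show ?thesis .
  qed
  have exp0: "((\<lambda>c. exp (c * z)) \<longlongrightarrow> 0) at_top" if "z < 0" for z :: real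
    using that by real_asymp
  \<comment> \<open>The difference of the sums is divided by \<open>exp (c * M)\<close>: the linear
    terms vanish in the limit because \<open>M > 0\<close>, so do the exponentials with
    \<open>y < M\<close>, and \<open>m M\<close> remains.\<close>
  have "((\<lambda>c. \<Sum>y\<in>F. m y * (y * exp (c * (- M)) + exp (c * (y - M)))) \<longlongrightarrow>
      (\<Sum>y\<in>F. m y * (y * 0 + (if y = M then 1 else 0)))) at_top"
  proof (intro tendsto_intros)
    show "((\<lambda>c. exp (c * (- M))) \<longlongrightarrow> 0) at_top"
      using exp0[of "- M"] M0 by simp
    fix y assume "y \<in> F"
    then show "((\<lambda>c. exp (c * (y - M))) \<longlongrightarrow> (if y = M then 1 else 0)) at_top"
      using exp0[of "y - M"] le[of y] by auto
  qed
  also have "(\<Sum>y\<in>F. m y * (y * 0 + (if y = M then 1 else 0))) = m M"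
    using fin M by (simp add: if_distrib[of "\<lambda>x. _ * x"] cong: if_cong)
  finally have lim:
    "((\<lambda>c. \<Sum>y\<in>F. m y * (y * exp (c * (- M)) + exp (c * (y - M)))) \<longlongrightarrow> m M) at_top" .
  have "m M \<noteq> 0"
    using M by (simp add: F_def)
  with lim have "eventually
      (\<lambda>c. (\<Sum>y\<in>F. m y * (y * exp (c * (- M)) + exp (c * (y - M)))) \<noteq> 0) at_top"
    by (rule tendsto_imp_eventually_ne)
  then show ?thesis
  proof eventually_elim
    case (elim c)
    have "(\<Sum>y\<in>F. m y * (y * exp (c * (- M)) + exp (c * (y - M))))
        = exp (c * (- M)) * (\<Sum>y\<in>F. m y * (y + exp (c * y)))"
      unfolding sum_distrib_left
    proof (rule sum.cong)
      fix y
      have "exp (c * (y - M)) = exp (c * (- M)) * exp (c * y)"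
        by (simp add: right_diff_distrib flip: exp_add)
      then show "m y * (y * exp (c * (- M)) + exp (c * (y - M))) =
          exp (c * (- M)) * (m y * (y + exp (c * y)))"
        by (simp only: distrib_left mult_ac)
    qed simp
    then show ?case
      using elim diff[of "\<lambda>y. y + exp (c * y)"] by auto
  qed
qed

section \<open>Transformers acting on one coordinate\<close>

definition scalar_gt :: "(real \<Rightarrow> real) \<Rightarrow> ('d, 'p) rpe_layer list \<Rightarrow> ('d, 'p) rpe_gt" where
  "scalar_gt \<sigma> Ls =
     \<lparr>num_heads = 1, head_dim = 1, ff_dim = 1, activation = \<sigma>, layers = Ls\<rparr>"

text \<open>A layer reads only the sizes and the activation from the network. With the list fixed to
  \<open>[]\<close>, layers can be appended while the layer function stays the same.\<close>

lemma gt_layer_scalar_gt: "gt_layer (scalar_gt \<sigma> Ls) = gt_layer (scalar_gt \<sigma> [])"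
  by (simp add: fun_eq_iff gt_layer_def attention_def scalar_gt_def)

text \<open>The factor \<open>n\<close> is the number of nodes; it cancels the denominator of the uniform softmax.\<close>

definition scalar_layer ::
  "'d \<Rightarrow> 'p set \<Rightarrow> nat \<Rightarrow> real \<Rightarrow> ('d \<Rightarrow> real) \<Rightarrow> ('d, 'p) rpe_layer" where
  "scalar_layer i\<^sub>0 E n a w =
     \<lparr>heads = (\<lambda>_. \<lparr>W_Q = (\<lambda>_ _. 0), W_K = (\<lambda>_ _. 0), W_V = (\<lambda>i _. if i = i\<^sub>0 then a else 0),
        f\<^sub>1 = (\<lambda>p. if p \<in> E then real n else 0), f\<^sub>2 = (\<lambda>_. 0)\<rparr>),
      W_O = (\<lambda>_ i. if i = i\<^sub>0 then 1 else 0), W\<^sub>1 = (\<lambda>i _. w i),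
      W\<^sub>2 = (\<lambda>_ i. if i = i\<^sub>0 then 1 else 0)\<rparr>"

lemma simple_graph_neighbours:
  assumes "simple_graph G"
  shows "{u, v} \<in> edges G \<Longrightarrow> u \<in> verts G" and "finite {u. {u, v} \<in> edges G}"
proof -
  show *: "u \<in> verts G" if "{u, v} \<in> edges G" for u
    using assms that by (auto simp: simple_graph_def)
  show "finite {u. {u, v} \<in> edges G}"
    by (rule finite_subset[of _ "verts G"]) (use assms * in \<open>auto simp: simple_graph_def\<close>)
qed

text \<open>Zero query and key weights make the softmax equal to \<open>1 / n\<close>, and the
  factor \<open>n\<close> in \<open>f\<^sub>1\<close> turns attention into the adjacency matrix.
  Thus \<open>y\<close> is the coordinate \<open>i\<^sub>0\<close> after attention, the other
  coordinates are kept there, and the feed-forward part adds the activation of one linear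
  form.\<close>

lemma gt_layer_scalar_layer:
  fixes X :: "'v \<Rightarrow> 'd::finite \<Rightarrow> real"
  assumes G: "simple_graph G" and v: "v \<in> verts G" and n: "card (verts G) = n"
    and E: "\<And>u v. u \<in> verts G \<Longrightarrow> v \<in> verts G \<Longrightarrow> P u v \<in> E \<longleftrightarrow> {u, v} \<in> edges G"
    and y: "y = X v i\<^sub>0 + a * (\<Sum>u | {u, v} \<in> edges G. X u i\<^sub>0)"
  shows "gt_layer (scalar_gt \<sigma> Ls) (verts G) P (scalar_layer i\<^sub>0 E n a w) X v i\<^sub>0 =
    y + \<sigma> (\<Sum>i\<in>UNIV. (if i = i\<^sub>0 then y else X v i) * w i)"
proof -
  let ?V = "verts G"
  define h where "h = heads (scalar_layer i\<^sub>0 E n a w) 0"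
  have fin: "finite ?V"
    using G by (simp add: simple_graph_def)
  have n0: "n \<noteq> 0"
    using fin v n card_0_eq by blast
  have att: "attention (scalar_gt \<sigma> Ls) ?V P h X v u = (if {u, v} \<in> edges G then 1 else 0)"
    if "u \<in> ?V" for u
    using n0 n E[OF v that]
    by (simp add: attention_def h_def scalar_layer_def softmax_def mat_prod_def Let_def
        insert_commute)
  have sum: "mat_prod ?V (attention (scalar_gt \<sigma> Ls) ?V P h X) X v i\<^sub>0 =
      (\<Sum>u | {u, v} \<in> edges G. X u i\<^sub>0)"
  proof -
    have "mat_prod ?V (attention (scalar_gt \<sigma> Ls) ?V P h X) X v i\<^sub>0 =
        (\<Sum>u\<in>?V. if {u, v} \<in> edges G then X u i\<^sub>0 else 0)"
      unfolding mat_prod_def by (rule sum.cong) (simp_all add: att)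
    also have "\<dots> = (\<Sum>u\<in>?V \<inter> {u. {u, v} \<in> edges G}. X u i\<^sub>0)"
      using fin by (simp add: sum.inter_restrict)
    also have "?V \<inter> {u. {u, v} \<in> edges G} = {u. {u, v} \<in> edges G}"
      using simple_graph_neighbours(1)[OF G] by blast
    finally show ?thesis .
  qed
  define Z where "Z = mat_prod ?V (attention (scalar_gt \<sigma> Ls) ?V P h X) X"
  have Z: "(\<Sum>j\<in>UNIV. Z v j * (if j = i\<^sub>0 then a else 0)) = a * (\<Sum>u | {u, v} \<in> edges G. X u i\<^sub>0)"
  proof -
    have "(\<Sum>j\<in>UNIV. Z v j * (if j = i\<^sub>0 then a else 0)) =
        (\<Sum>j\<in>UNIV. if j = i\<^sub>0 then a * Z v j else 0)"
      by (rule sum.cong) auto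
    also have "\<dots> = a * Z v i\<^sub>0"
      by simp
    finally show ?thesis
      by (simp only: Z_def sum)
  qed
  have Y: "X v i + (\<Sum>j\<in>UNIV. Z v j * (if j = i\<^sub>0 then a else 0)) * (if i = i\<^sub>0 then 1 else 0)
      = (if i = i\<^sub>0 then y else X v i)" for i
    by (simp add: Z y)
  have heads: "heads (scalar_layer i\<^sub>0 E n a w) k = h" for k
    by (simp add: scalar_layer_def h_def)
  have WV: "W_V h = (\<lambda>i _. if i = i\<^sub>0 then a else 0)"
    by (simp add: scalar_layer_def h_def)
  have dims: "num_heads (scalar_gt \<sigma> Ls) = 1" "head_dim (scalar_gt \<sigma> Ls) = 1"
    "ff_dim (scalar_gt \<sigma> Ls) = 1" "activation (scalar_gt \<sigma> Ls) = \<sigma>"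
    by (simp_all add: scalar_gt_def)
  have W: "W_O (scalar_layer i\<^sub>0 E n a w) = (\<lambda>_ i. if i = i\<^sub>0 then 1 else 0)"
    "W\<^sub>1 (scalar_layer i\<^sub>0 E n a w) = (\<lambda>i _. w i)"
    "W\<^sub>2 (scalar_layer i\<^sub>0 E n a w) = (\<lambda>_ i. if i = i\<^sub>0 then 1 else 0)"
    by (simp_all add: scalar_layer_def)
  show ?thesis
    unfolding gt_layer_def heads dims W Z_def[symmetric] WV Let_def
    using Y[of i\<^sub>0] by (simp add: Y mat_prod_def lessThan_Suc)
qed

text \<open>With \<open>w\<close> supported at \<open>i\<^sub>0\<close> the other coordinates drop
  out. Agreement with \<open>exp\<close> is asked only at \<open>c * y\<close>, since the activation
  used later may deviate from \<open>exp\<close> at finitely many points.\<close>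

lemma gt_layer_exp:
  fixes X :: "'v \<Rightarrow> 'd::finite \<Rightarrow> real"
  assumes "simple_graph G" and "v \<in> verts G" and "card (verts G) = n"
    and "\<And>u v. u \<in> verts G \<Longrightarrow> v \<in> verts G \<Longrightarrow> P u v \<in> E \<longleftrightarrow> {u, v} \<in> edges G"
    and y: "y = X v i\<^sub>0 + a * (\<Sum>u | {u, v} \<in> edges G. X u i\<^sub>0)"
    and \<sigma>: "\<sigma> (c * y) = exp (c * y)"
  shows "gt_layer (scalar_gt \<sigma> Ls) (verts G) P
      (scalar_layer i\<^sub>0 E n a (\<lambda>i. if i = i\<^sub>0 then c else 0)) X v i\<^sub>0 = y + exp (c * y)"
proof -
  have "(\<Sum>i\<in>UNIV. (if i = i\<^sub>0 then y else X v i) * (if i = i\<^sub>0 then c else 0)) =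
      (\<Sum>i\<in>UNIV. if i = i\<^sub>0 then c * y else 0)"
    by (rule sum.cong) auto
  also have "\<dots> = c * y"
    by simp
  finally show ?thesis
    using gt_layer_scalar_layer[where X = X and v = v and i\<^sub>0 = i\<^sub>0 and P = P and E = E and y = y,
        OF assms(1-5)] \<sigma> by simp
qed

text \<open>The residual term is strictly increasing, and for \<open>c \<ge> 0\<close> the
  exponential is nondecreasing.\<close>

lemma add_exp_eq_iff:
  fixes x y :: real
  assumes "c \<ge> 0"
  shows "x + exp (c * x) = y + exp (c * y) \<longleftrightarrow> x = y"
proof -
  have "x + exp (c * x) < y + exp (c * y)" if "x < y" for x y
    using that assms by (intro add_less_le_mono) (auto intro: mult_left_mono)
  then show ?thesis
    by (metis linorder_neqE order_less_irrefl)
qed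

text \<open>Serves to push arguments of the activation beyond \<open>M\<close>, where it equals
  \<open>exp\<close>.\<close>

lemma eventually_scaled_gt:
  fixes F :: "real set"
  assumes "finite F" and "\<forall>y\<in>F. y > 0"
  shows "eventually (\<lambda>c. c \<ge> 0 \<and> (\<forall>y\<in>F. c * y > M)) at_top"
proof -
  have "eventually (\<lambda>c. c * y > M) at_top" if "y > 0" for y :: real
    using eventually_gt_at_top[of "M / y"] by eventually_elim (use that in \<open>simp add: field_simps\<close>)
  then show ?thesis
    using assms by (intro eventually_conj eventually_ge_at_top eventually_ball_finite) auto
qed

section \<open>Simulation of one message passing step\<close>

text \<open>Attention sums before the activation acts, hence two layers: the first transforms the
  node values so that sums determine multisets, the second forms the sums. The parameters are chosen
  for both graphs together, and positivity is kept so that the step can be iterated.\<close>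

lemma two_layers_simulate_message_passing:
  fixes X Y :: "'v \<Rightarrow> 'd::finite \<Rightarrow> real"
  assumes G: "simple_graph G" and H: "simple_graph H"
    and n: "card (verts G) = n" "card (verts H) = n"
    and EG: "\<And>u v. u \<in> verts G \<Longrightarrow> v \<in> verts G \<Longrightarrow> P u v \<in> E \<longleftrightarrow> {u, v} \<in> edges G"
    and EH: "\<And>u v. u \<in> verts H \<Longrightarrow> v \<in> verts H \<Longrightarrow> Q u v \<in> E \<longleftrightarrow> {u, v} \<in> edges H"
    and \<sigma>: "\<And>z. z > M \<Longrightarrow> \<sigma> z = exp z"
    and posG: "\<forall>v\<in>verts G. X v i\<^sub>0 > 0" and posH: "\<forall>v\<in>verts H. Y v i\<^sub>0 > 0"
  obtains L L' where
    "\<forall>v\<in>verts G. fold (gt_layer (scalar_gt \<sigma> []) (verts G) P) [L, L'] X v i\<^sub>0 > 0"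
    "\<forall>v\<in>verts H. fold (gt_layer (scalar_gt \<sigma> []) (verts H) Q) [L, L'] Y v i\<^sub>0 > 0"
    "\<forall>v\<in>verts G. \<forall>v'\<in>verts H.
       fold (gt_layer (scalar_gt \<sigma> []) (verts G) P) [L, L'] X v i\<^sub>0 =
       fold (gt_layer (scalar_gt \<sigma> []) (verts H) Q) [L, L'] Y v' i\<^sub>0 \<longrightarrow>
       X v i\<^sub>0 = Y v' i\<^sub>0 \<and>
       image_mset (\<lambda>u. X u i\<^sub>0) (mset_set {u. {u, v} \<in> edges G}) =
       image_mset (\<lambda>u. Y u i\<^sub>0) (mset_set {u. {u, v'} \<in> edges H})"
proof -
  have fin: "finite (verts G)" "finite (verts H)"
    using G H by (auto simp: simple_graph_def)
  note nb = simple_graph_neighbours[OF G] simple_graph_neighbours[OF H]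
  define A where "A v = image_mset (\<lambda>u. X u i\<^sub>0) (mset_set {u. {u, v} \<in> edges G})" for v
  define B where "B v = image_mset (\<lambda>u. Y u i\<^sub>0) (mset_set {u. {u, v} \<in> edges H})" for v
  let ?g = "\<lambda>c y. y + exp (c * y) :: real"
  have pos: "\<forall>y \<in># A v + B v'. y > 0" for v v'
    using nb posG posH by (auto simp: A_def B_def)
  \<comment> \<open>Only finitely many pairs of neighbourhood multisets occur, so one large
    \<open>c\<close> separates them all.\<close>
  have "eventually (\<lambda>c. \<forall>v\<in>verts G. \<forall>v'\<in>verts H.
      A v \<noteq> B v' \<longrightarrow> (\<Sum>y\<in>#A v. ?g c y) \<noteq> (\<Sum>y\<in>#B v'. ?g c y)) at_top"
  proof (intro eventually_ball_finite fin ballI)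
    show "eventually (\<lambda>c.
        A v \<noteq> B v' \<longrightarrow> (\<Sum>y\<in>#A v. ?g c y) \<noteq> (\<Sum>y\<in>#B v'. ?g c y)) at_top" for v v'
      using eventually_sum_exp_separates[OF pos] by (cases "A v = B v'") auto
  qed
  moreover have "eventually (\<lambda>c. c \<ge> 0 \<and>
      (\<forall>y\<in>(\<lambda>v. X v i\<^sub>0) ` verts G \<union> (\<lambda>v. Y v i\<^sub>0) ` verts H. c * y > M)) at_top"
    using posG posH fin by (intro eventually_scaled_gt) auto
  ultimately have "eventually (\<lambda>c. (\<forall>v\<in>verts G. \<forall>v'\<in>verts H.
      A v \<noteq> B v' \<longrightarrow> (\<Sum>y\<in>#A v. ?g c y) \<noteq> (\<Sum>y\<in>#B v'. ?g c y)) \<and> c \<ge> 0 \<and>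
      (\<forall>y\<in>(\<lambda>v. X v i\<^sub>0) ` verts G \<union> (\<lambda>v. Y v i\<^sub>0) ` verts H. c * y > M)) at_top"
    by (rule eventually_conj)
  then obtain c where c: "c \<ge> 0"
      "\<forall>v\<in>verts G. c * X v i\<^sub>0 > M" "\<forall>v\<in>verts H. c * Y v i\<^sub>0 > M"
    and sep: "\<forall>v\<in>verts G. \<forall>v'\<in>verts H.
      A v \<noteq> B v' \<longrightarrow> (\<Sum>y\<in>#A v. ?g c y) \<noteq> (\<Sum>y\<in>#B v'. ?g c y)"
    using eventually_happens'[OF trivial_limit_at_top_linorder] by force
  \<comment> \<open>Attention weight 0: this layer applies \<open>?g c\<close> to each node
    separately.\<close>
  define L where "L = scalar_layer i\<^sub>0 E n 0 (\<lambda>i. if i = i\<^sub>0 then c else 0)"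
  define X' where "X' = gt_layer (scalar_gt \<sigma> []) (verts G) P L X"
  define Y' where "Y' = gt_layer (scalar_gt \<sigma> []) (verts H) Q L Y"
  have X': "X' v i\<^sub>0 = ?g c (X v i\<^sub>0)" if "v \<in> verts G" for v
    unfolding X'_def L_def by (rule gt_layer_exp[OF G that n(1) EG]) (use c that \<sigma> in auto)
  have Y': "Y' v i\<^sub>0 = ?g c (Y v i\<^sub>0)" if "v \<in> verts H" for v
    unfolding Y'_def L_def by (rule gt_layer_exp[OF H that n(2) EH]) (use c that \<sigma> in auto)
  have posX': "X' v i\<^sub>0 > 0" if "v \<in> verts G" for v
    using X'[OF that] posG that by (simp add: add_pos_pos)
  have posY': "Y' v i\<^sub>0 > 0" if "v \<in> verts H" for v
    using Y'[OF that] posH that by (simp add: add_pos_pos)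
  define S where "S v = (\<Sum>u | {u, v} \<in> edges G. X' u i\<^sub>0)" for v
  define T where "T v = (\<Sum>u | {u, v} \<in> edges H. Y' u i\<^sub>0)" for v
  \<comment> \<open>Not strict, as a vertex may be isolated.\<close>
  have S0: "S v \<ge> 0" for v
    unfolding S_def using nb posX' by (intro sum_nonneg) (auto intro: less_imp_le)
  have T0: "T v \<ge> 0" for v
    unfolding T_def using nb posY' by (intro sum_nonneg) (auto intro: less_imp_le)
  have S: "S v = (\<Sum>y\<in>#A v. ?g c y)" for v
    unfolding S_def A_def using nb X'
    by (simp add: multiset.map_comp comp_def sum_unfold_sum_mset[symmetric])
  have T: "T v = (\<Sum>y\<in>#B v. ?g c y)" for v
    unfolding T_def B_def using nb Y'
    by (simp add: multiset.map_comp comp_def sum_unfold_sum_mset[symmetric])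
  \<comment> \<open>A large \<open>a\<close> makes own value plus \<open>a\<close> times neighbour
    sum determine both, when compared across the graphs.\<close>
  have "eventually (\<lambda>a. \<forall>v\<in>verts G. \<forall>v'\<in>verts H.
      X' v i\<^sub>0 - Y' v' i\<^sub>0 \<noteq> 0 \<or> S v - T v' \<noteq> 0 \<longrightarrow>
      X' v i\<^sub>0 - Y' v' i\<^sub>0 + a * (S v - T v') \<noteq> 0) at_top"
  proof (intro eventually_ball_finite fin ballI)
    show "eventually (\<lambda>a. X' v i\<^sub>0 - Y' v' i\<^sub>0 \<noteq> 0 \<or> S v - T v' \<noteq> 0 \<longrightarrow>
        X' v i\<^sub>0 - Y' v' i\<^sub>0 + a * (S v - T v') \<noteq> 0) at_top" for v v'
      using eventually_affine_nonzero[of "X' v i\<^sub>0 - Y' v' i\<^sub>0" "S v - T v'"]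
      by (cases "X' v i\<^sub>0 - Y' v' i\<^sub>0 \<noteq> 0 \<or> S v - T v' \<noteq> 0") (simp_all only: simp_thms eventually_True)
  qed
  then have "eventually (\<lambda>a. (\<forall>v\<in>verts G. \<forall>v'\<in>verts H.
      X' v i\<^sub>0 - Y' v' i\<^sub>0 \<noteq> 0 \<or> S v - T v' \<noteq> 0 \<longrightarrow>
      X' v i\<^sub>0 - Y' v' i\<^sub>0 + a * (S v - T v') \<noteq> 0) \<and> a \<ge> 0) at_top"
    by (intro eventually_conj eventually_ge_at_top)
  then obtain a where a: "a \<ge> 0" and inj: "\<forall>v\<in>verts G. \<forall>v'\<in>verts H.
      X' v i\<^sub>0 - Y' v' i\<^sub>0 \<noteq> 0 \<or> S v - T v' \<noteq> 0 \<longrightarrow>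
      X' v i\<^sub>0 - Y' v' i\<^sub>0 + a * (S v - T v') \<noteq> 0"
    using eventually_happens'[OF trivial_limit_at_top_linorder] by blast
  define p where "p v = X' v i\<^sub>0 + a * S v" for v
  define q where "q v = Y' v i\<^sub>0 + a * T v" for v
  have p0: "p v > 0" if "v \<in> verts G" for v
    unfolding p_def using posX'[OF that] a S0 by (intro add_pos_nonneg mult_nonneg_nonneg)
  have q0: "q v > 0" if "v \<in> verts H" for v
    unfolding q_def using posY'[OF that] a T0 by (intro add_pos_nonneg mult_nonneg_nonneg)
  \<comment> \<open>The second layer also applies its activation; a scale \<open>d\<close> with
    arguments above \<open>M\<close> turns this into the injective map \<open>?g d\<close>.\<close>
  have "eventually (\<lambda>c. c \<ge> 0 \<and> (\<forall>y\<in>p ` verts G \<union> q ` verts H. c * y > M)) at_top"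
    using p0 q0 fin by (intro eventually_scaled_gt) auto
  then obtain d where d: "d \<ge> 0" "\<forall>v\<in>verts G. d * p v > M" "\<forall>v\<in>verts H. d * q v > M"
    using eventually_happens'[OF trivial_limit_at_top_linorder] by force
  define L' where "L' = scalar_layer i\<^sub>0 E n a (\<lambda>i. if i = i\<^sub>0 then d else 0)"
  have outG: "fold (gt_layer (scalar_gt \<sigma> []) (verts G) P) [L, L'] X v i\<^sub>0 = ?g d (p v)"
    if "v \<in> verts G" for v
  proof -
    have "gt_layer (scalar_gt \<sigma> []) (verts G) P L' X' v i\<^sub>0 = ?g d (p v)"
      unfolding L'_def
      by (rule gt_layer_exp[OF G that n(1) EG]) (use d that \<sigma> in \<open>auto simp: p_def S_def\<close>)
    then show ?thesis
      by (simp add: X'_def)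
  qed
  have outH: "fold (gt_layer (scalar_gt \<sigma> []) (verts H) Q) [L, L'] Y v i\<^sub>0 = ?g d (q v)"
    if "v \<in> verts H" for v
  proof -
    have "gt_layer (scalar_gt \<sigma> []) (verts H) Q L' Y' v i\<^sub>0 = ?g d (q v)"
      unfolding L'_def
      by (rule gt_layer_exp[OF H that n(2) EH]) (use d that \<sigma> in \<open>auto simp: q_def T_def\<close>)
    then show ?thesis
      by (simp add: Y'_def)
  qed
  \<comment> \<open>The choices are undone in reverse order: \<open>d\<close> yields
    \<open>p v = q v'\<close>, then \<open>a\<close> yields equal own values and sums, then
    \<open>c\<close> equal old values and neighbour multisets.\<close>
  have "X v i\<^sub>0 = Y v' i\<^sub>0 \<and> A v = B v'"
    if v: "v \<in> verts G" "v' \<in> verts H" and eq: "?g d (p v) = ?g d (q v')" for v v'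
  proof -
    have "p v = q v'"
      using eq add_exp_eq_iff[OF d(1)] by blast
    then have "X' v i\<^sub>0 - Y' v' i\<^sub>0 + a * (S v - T v') = 0"
      by (simp add: p_def q_def algebra_simps)
    then have "X' v i\<^sub>0 = Y' v' i\<^sub>0" "S v = T v'"
      using inj v by auto
    then show ?thesis
      using sep v add_exp_eq_iff[OF c(1)] X' Y' S T by metis
  qed
  then show ?thesis
    using that[of L L'] p0 q0 unfolding A_def B_def
    by (metis (no_types, lifting) outG outH add_pos_pos exp_gt_zero)
qed

section \<open>Simulation of whole networks\<close>

text \<open>\<open>E\<close> collects the encodings of edges of all simple graphs; by awareness no
  non-edge has such a value. So the indicator of one set, placed in \<open>f\<^sub>1\<close>, finds
  the edges of both graphs.\<close>

lemma combinatorially_aware_edge_values: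
  assumes "combinatorially_aware \<psi>" and "simple_graph G" and "simple_graph H"
  obtains E where
    "\<And>u v. u \<in> verts G \<Longrightarrow> v \<in> verts G \<Longrightarrow> \<psi> G u v \<in> E \<longleftrightarrow> {u, v} \<in> edges G"
    "\<And>u v. u \<in> verts H \<Longrightarrow> v \<in> verts H \<Longrightarrow> \<psi> H u v \<in> E \<longleftrightarrow> {u, v} \<in> edges H"
proof -
  define E where "E = {\<psi> K u v |K u v.
    simple_graph K \<and> u \<in> verts K \<and> v \<in> verts K \<and> {u, v} \<in> edges K}"
  have "\<psi> K u v \<in> E \<longleftrightarrow> {u, v} \<in> edges K"
    if "simple_graph K" "u \<in> verts K" "v \<in> verts K" for K u v
    using that assms(1) unfolding E_def combinatorially_aware_def by blast
  then show ?thesis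
    using that assms by blast
qed

text \<open>Induction on \<open>t\<close>, each step costing two layers. The network may depend on
  both graphs and their features; equal node counts allow the same factor \<open>n\<close> for
  both.\<close>

lemma transformers_simulate_mpnn:
  fixes \<psi> :: "'v ugraph \<Rightarrow> 'v \<Rightarrow> 'v \<Rightarrow> 'p"
    and X Y :: "'v \<Rightarrow> real ^ 'd"
    and N :: "((real ^ 'd) + 'b, 'm) mpnn"
    and i\<^sub>0 :: 'd
  assumes "combinatorially_aware \<psi>" and G: "simple_graph G" and H: "simple_graph H"
    and card: "card (verts G) = card (verts H)"
  shows "\<exists>\<sigma> Ls. \<forall>v\<in>verts G. \<forall>v'\<in>verts H.
    gt_output \<psi> (scalar_gt \<sigma> Ls) G X v $ i\<^sub>0 = gt_output \<psi> (scalar_gt \<sigma> Ls) H Y v' $ i\<^sub>0 \<longrightarrow>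
    mpnn_features N G (\<lambda>v. Inl (X v)) t v = mpnn_features N H (\<lambda>v. Inl (Y v)) t v'"
proof -
  obtain E where
    EG: "\<And>u v. u \<in> verts G \<Longrightarrow> v \<in> verts G \<Longrightarrow> \<psi> G u v \<in> E \<longleftrightarrow> {u, v} \<in> edges G" and
    EH: "\<And>u v. u \<in> verts H \<Longrightarrow> v \<in> verts H \<Longrightarrow> \<psi> H u v \<in> E \<longleftrightarrow> {u, v} \<in> edges H"
    using combinatorially_aware_edge_values[OF assms(1) G H] by metis
  define n where "n = card (verts H)"
  have n: "card (verts G) = n" "card (verts H) = n"
    using card by (simp_all add: n_def)
  define F where "F = X ` verts G \<union> Y ` verts H"
  have fin: "finite F"
    using G H by (simp add: F_def simple_graph_def)
  obtain w where w: "inj_on (\<lambda>x. x \<bullet> w) F"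
    using exists_inj_on_inner[OF fin] by blast
  \<comment> \<open>At the projection of an input \<open>x\<close> the activation is lowered by
    \<open>x $ i\<^sub>0\<close>. This cancels the residual term, so the first layer produces
    \<open>exp (x \<bullet> w)\<close>, which is positive and injective on the inputs.\<close>
  define \<sigma> where "\<sigma> z = exp z -
    (if z \<in> (\<lambda>x. x \<bullet> w) ` F then inv_into F (\<lambda>x. x \<bullet> w) z $ i\<^sub>0 else 0)" for z
  \<comment> \<open>All corrected points are at most \<open>M\<close>; the inserted 0 keeps the set
    nonempty.\<close>
  define M where "M = Max (insert 0 ((\<lambda>x. x \<bullet> w) ` F))"
  have \<sigma>_large: "\<sigma> z = exp z" if "z > M" for z
    using that fin by (auto simp: \<sigma>_def M_def)
  have \<sigma>_F: "x $ i\<^sub>0 + \<sigma> (x \<bullet> w) = exp (x \<bullet> w)" if "x \<in> F" for x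
    using that inv_into_f_f[OF w that] by (simp add: \<sigma>_def)
  define f where "f Ls = fold (gt_layer (scalar_gt \<sigma> []) (verts G) (\<psi> G)) Ls (\<lambda>v i. X v $ i)" for Ls
  define g where "g Ls = fold (gt_layer (scalar_gt \<sigma> []) (verts H) (\<psi> H)) Ls (\<lambda>v i. Y v $ i)" for Ls
  \<comment> \<open>Positivity is part of the claim because the two-layer step requires it. \<sigma>
    is fixed before the induction, hence shared by all layers.\<close>
  have "\<exists>Ls. (\<forall>v\<in>verts G. f Ls v i\<^sub>0 > 0) \<and> (\<forall>v\<in>verts H. g Ls v i\<^sub>0 > 0) \<and>
    (\<forall>v\<in>verts G. \<forall>v'\<in>verts H. f Ls v i\<^sub>0 = g Ls v' i\<^sub>0 \<longrightarrow>
      mpnn_features N G (\<lambda>v. Inl (X v)) t v = mpnn_features N H (\<lambda>v. Inl (Y v)) t v')"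
  proof (induction t)
    case 0
    define L :: "('d, 'p) rpe_layer" where "L = scalar_layer i\<^sub>0 E n 0 (\<lambda>i. w $ i)"
    have inner: "(\<Sum>i\<in>UNIV. (if i = i\<^sub>0 then x $ i\<^sub>0 else x $ i) * w $ i) = x \<bullet> w" for x
      unfolding inner_vec_def by (rule sum.cong) auto
    have f: "f [L] v i\<^sub>0 = exp (X v \<bullet> w)" if "v \<in> verts G" for v
      using gt_layer_scalar_layer[where X = "\<lambda>v i. X v $ i" and v = v and i\<^sub>0 = i\<^sub>0 and a = 0 and
          y = "X v $ i\<^sub>0", OF G that n(1) EG _, of \<sigma> "[]" "\<lambda>i. w $ i"] \<sigma>_F[of "X v"] that
      by (simp add: f_def L_def inner F_def)
    have g: "g [L] v i\<^sub>0 = exp (Y v \<bullet> w)" if "v \<in> verts H" for v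
      using gt_layer_scalar_layer[where X = "\<lambda>v i. Y v $ i" and v = v and i\<^sub>0 = i\<^sub>0 and a = 0 and
          y = "Y v $ i\<^sub>0", OF H that n(2) EH _, of \<sigma> "[]" "\<lambda>i. w $ i"] \<sigma>_F[of "Y v"] that
      by (simp add: g_def L_def inner F_def)
    show ?case
      using w by (intro exI[of _ "[L]"]) (auto simp: f g F_def dest: inj_onD)
  next
    case (Suc t)
    then obtain Ls where Ls: "\<forall>v\<in>verts G. f Ls v i\<^sub>0 > 0" "\<forall>v\<in>verts H. g Ls v i\<^sub>0 > 0"
      and IH: "\<And>v v'. v \<in> verts G \<Longrightarrow> v' \<in> verts H \<Longrightarrow> f Ls v i\<^sub>0 = g Ls v' i\<^sub>0 \<Longrightarrow>
        mpnn_features N G (\<lambda>v. Inl (X v)) t v = mpnn_features N H (\<lambda>v. Inl (Y v)) t v'"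
      by blast
    obtain L L' where LL:
      "\<forall>v\<in>verts G. fold (gt_layer (scalar_gt \<sigma> []) (verts G) (\<psi> G)) [L, L'] (f Ls) v i\<^sub>0 > 0"
      "\<forall>v\<in>verts H. fold (gt_layer (scalar_gt \<sigma> []) (verts H) (\<psi> H)) [L, L'] (g Ls) v i\<^sub>0 > 0"
      "\<forall>v\<in>verts G. \<forall>v'\<in>verts H.
         fold (gt_layer (scalar_gt \<sigma> []) (verts G) (\<psi> G)) [L, L'] (f Ls) v i\<^sub>0 =
         fold (gt_layer (scalar_gt \<sigma> []) (verts H) (\<psi> H)) [L, L'] (g Ls) v' i\<^sub>0 \<longrightarrow>
         f Ls v i\<^sub>0 = g Ls v' i\<^sub>0 \<and>
         image_mset (\<lambda>u. f Ls u i\<^sub>0) (mset_set {u. {u, v} \<in> edges G}) =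
         image_mset (\<lambda>u. g Ls u i\<^sub>0) (mset_set {u. {u, v'} \<in> edges H})"
      by (rule two_layers_simulate_message_passing[where X = "f Ls" and Y = "g Ls" and i\<^sub>0 = i\<^sub>0,
            OF G H n EG EH \<sigma>_large Ls])
    have "mpnn_features N G (\<lambda>v. Inl (X v)) (Suc t) v = mpnn_features N H (\<lambda>v. Inl (Y v)) (Suc t) v'"
      if v: "v \<in> verts G" "v' \<in> verts H"
        and eq: "f (Ls @ [L, L']) v i\<^sub>0 = g (Ls @ [L, L']) v' i\<^sub>0" for v v'
    proof -
      have "f Ls v i\<^sub>0 = g Ls v' i\<^sub>0 \<and>
          image_mset (\<lambda>u. f Ls u i\<^sub>0) (mset_set {u. {u, v} \<in> edges G}) =
          image_mset (\<lambda>u. g Ls u i\<^sub>0) (mset_set {u. {u, v'} \<in> edges H})"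
        using LL(3)[rule_format, OF v] eq by (simp add: f_def g_def)
      \<comment> \<open>By the induction hypothesis equal numbers at neighbours mean equal features,
        so equality of the multisets transfers.\<close>
      moreover from this
      have "image_mset (mpnn_features N G (\<lambda>v. Inl (X v)) t) (mset_set {u. {u, v} \<in> edges G}) =
          image_mset (mpnn_features N H (\<lambda>v. Inl (Y v)) t) (mset_set {u. {u, v'} \<in> edges H})"
        by (elim conjE image_mset_eq_transfer)
           (use IH simple_graph_neighbours[OF G] simple_graph_neighbours[OF H] in auto)
      ultimately show ?thesis
        using IH[OF v] by simp
    qed
    then show ?case
      using LL(1,2) by (intro exI[of _ "Ls @ [L, L']"]) (simp add: f_def g_def)
  qed
  then obtain Ls where Ls: "\<forall>v\<in>verts G. \<forall>v'\<in>verts H. f Ls v i\<^sub>0 = g Ls v' i\<^sub>0 \<longrightarrow>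
      mpnn_features N G (\<lambda>v. Inl (X v)) t v = mpnn_features N H (\<lambda>v. Inl (Y v)) t v'"
    by blast
  have "layers (scalar_gt \<sigma> Ls) = Ls"
    by (simp add: scalar_gt_def)
  then have "gt_output \<psi> (scalar_gt \<sigma> Ls) G X v $ i\<^sub>0 = f Ls v i\<^sub>0"
    "gt_output \<psi> (scalar_gt \<sigma> Ls) H Y v $ i\<^sub>0 = g Ls v i\<^sub>0" for v
    by (simp_all add: gt_output_def f_def g_def gt_layer_scalar_gt[of \<sigma> Ls])
  then show ?thesis
    using Ls by metis
qed

theorem corollary4p16:
  fixes \<psi> :: "'v ugraph \<Rightarrow> 'v \<Rightarrow> 'v \<Rightarrow> real ^ 'k"
    and G H :: "'v ugraph"
    and X_G X_H :: "'v \<Rightarrow> real ^ 'd"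
  assumes "is_rpe \<psi>" and "combinatorially_aware \<psi>"
    and "simple_graph G" and "simple_graph H"
    and "\<forall>T :: ('d, real ^ 'k) rpe_gt. is_rpe_gt T \<longrightarrow> gt_indistinguishable \<psi> T G X_G H X_H"
  shows "\<forall>N :: ((real ^ 'd) + 'b, 'm) mpnn. mpnn_indistinguishable N G X_G H X_H"
proof
  fix N :: "((real ^ 'd) + 'b, 'm) mpnn"
  have gt: "image_mset (gt_output \<psi> (scalar_gt \<sigma> Ls) G X_G) (mset_set (verts G)) =
      image_mset (gt_output \<psi> (scalar_gt \<sigma> Ls) H X_H) (mset_set (verts H))" for \<sigma> Ls
    using assms(5) by (simp add: gt_indistinguishable_def is_rpe_gt_def scalar_gt_def)
  \<comment> \<open>The output of any transformer has one row per node, so comparing multiset sizes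
    compares node counts.\<close>
  have card: "card (verts G) = card (verts H)"
    using arg_cong[OF gt, of size] by simp
  \<comment> \<open>Any coordinate will do.\<close>
  fix i\<^sub>0 :: 'd
  obtain \<sigma> Ls where sim: "\<forall>v\<in>verts G. \<forall>v'\<in>verts H.
      gt_output \<psi> (scalar_gt \<sigma> Ls) G X_G v $ i\<^sub>0 = gt_output \<psi> (scalar_gt \<sigma> Ls) H X_H v' $ i\<^sub>0 \<longrightarrow>
      mpnn_features N G (\<lambda>v. Inl (X_G v)) (mpnn_depth N) v =
      mpnn_features N H (\<lambda>v. Inl (X_H v)) (mpnn_depth N) v'"
    using transformers_simulate_mpnn[OF assms(2-4) card] by blast
  show "mpnn_indistinguishable N G X_G H X_H"
    unfolding mpnn_indistinguishable_def
    by (rule image_mset_eq_transfer[OF gt[of \<sigma> Ls]])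
       (use sim assms(3,4) in \<open>simp add: simple_graph_def\<close>)
qed

end
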